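(* Let $m,n$ be relatively prime positive integers. An affine permutation $w\in\widetilde{\mathfrak{S}}_n$ satisfies $w^{-1}\in\mathcal{S}_m^n$ if and only if $[w(1),w(2),\ldots,w(n)]=n(\mathfrak{p})$ for some balanced $(m,n)$-filter tuple $\mathfrak{p}$.
   Context: $\widetilde{\mathfrak{S}}_n$ is the group of bijections $w:\mathbb{Z}\to\mathbb{Z}$ with $w(i+n)=w(i)+n$ and $\sum_{i=1}^n w(i)=\binom{n+1}{2}$. $\mathcal{S}_m^n$ is the Sommers region (bounded by the $n$ affine hyperplanes of height $m$ of the affine $\widetilde{\mathfrak{S}}_n$ arrangement); $w^{-1}\in\mathcal{S}_m^n$ means $w^{-1}$ labels an alcove in it, equivalently (known characterization) $w(i)-w(j)\ne m$ for all integers $i<j$. The level of $(i,j)\in\mathbb{Z}^2$ is $\ell(i,j)=im+jn$. An $(m,n)$-filter is a nonempty proper upward-closed (componentwise order) subset of $\mathbb{Z}^2$ containing, with any point, all points of the same level. $m(\mathfrak{i})$ is the set of $\min\{\ell(i,j):(i,j)\in\mathfrak{i}\}$ over rows $j\in\mathbb{Z}$, $n(\mathfrak{i})$ the set of such minima over columns $i\in\mathbb{Z}$. A filter $\mathfrak{b}$ is balanced if $\sum_{x\in m(\mathfrak{b})}x=\binom{m+1}{2}$ and $\sum_{y\in n(\mathfrak{b})}y=\binom{n+1}{2}$. An $(m,n)$-filter tuple is $(\mathfrak{p}^{(0)},\ldots,\mathfrak{p}^{(n)})$ with integers $p_0,\ldots,p_{n-1}$ such that $p_i\in m(\mathfrak{p}^{(i)})$,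 $m(\mathfrak{p}^{(i+1)})=(m(\mathfrak{p}^{(i)})\setminus\{p_i\})\cup\{p_i+m\}$ for $0\le i<n$, and $m(\mathfrak{p}^{(n)})=\{x+n:x\in m(\mathfrak{p}^{(0)})\}$; $n(\mathfrak{p})=[p_0,\ldots,p_{n-1}]$ (an ordered list). It is balanced if $\mathfrak{p}^{(0)}$ is balanced. *)

theory Defs
  imports Complex_Main "HOL-Library.FuncSet"
begin

subsection \<open>Affine permutations\<close>

definition affine_sym :: "nat \<Rightarrow> (int \<Rightarrow> int) set" where
  "affine_sym n = {w. bij w \<and> (\<forall>i. w (i + int n) = w i + int n)
     \<and> (\<Sum>i = 1..int n. w i) = int ((n + 1) choose 2)}"

subsection \<open>Alcoves and the Sommers region\<close>

text \<open>The ambient space is the hyperplane of coordinate sum zero in real n-space, with vectors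
  represented as extensional functions on \<open>{1..n}\<close>.\<close>

definition coroot_space :: "nat \<Rightarrow> (int \<Rightarrow> real) set" where
  "coroot_space n = {x \<in> extensional {1..int n}. (\<Sum>i = 1..int n. x i) = 0}"

text \<open>\<open>ext_coord n x\<close> extends the coordinates \<open>x 1, ..., x n\<close> to all integer indices
  by the rule \<open>x (i + n) = x i - 1\<close>. With this, the affine hyperplane belonging to the real
  positive root \<open>e_i - e_j + k \<delta>\<close>, namely \<open>x i - x j + k = 0\<close>, is the set where the extended
  coordinates at \<open>i\<close> and \<open>j + k n\<close> agree, and \<open>(j + k n) - i\<close> is the height of the root.\<close>

definition ext_coord :: "nat \<Rightarrow> (int \<Rightarrow> real) \<Rightarrow> int \<Rightarrow> real" where
  "ext_coord n x i = x ((i - 1) mod int n + 1) - of_int ((i - 1) div int n)"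

definition fundamental_alcove :: "nat \<Rightarrow> (int \<Rightarrow> real) set" where
  "fundamental_alcove n = {x \<in> coroot_space n.
     (\<forall>i \<in> {1..<int n}. x i > x (i + 1)) \<and> x (int n) > x 1 - 1}"

text \<open>The (left) action of the affine symmetric group: the extended coordinate of \<open>w x\<close>
  at \<open>w i\<close> is the extended coordinate of \<open>x\<close> at \<open>i\<close>.\<close>

definition affine_act :: "nat \<Rightarrow> (int \<Rightarrow> int) \<Rightarrow> (int \<Rightarrow> real) \<Rightarrow> int \<Rightarrow> real" where
  "affine_act n w x = (\<lambda>i \<in> {1..int n}. ext_coord n x (inv w i))"

text \<open>Labelling convention: \<open>u\<close> labels the image of the fundamental alcove under the inverse
  of \<open>u\<close>. Equivalently, the order of the values \<open>u a\<close> is the order in which the extended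
  coordinates decrease on the alcove.\<close>

definition alcove :: "nat \<Rightarrow> (int \<Rightarrow> int) \<Rightarrow> (int \<Rightarrow> real) set" where
  "alcove n u = affine_act n (inv u) ` fundamental_alcove n"

text \<open>The \<open>n\<close> hyperplanes of height \<open>m\<close> equate the extended coordinates at \<open>i\<close> and \<open>i + m\<close>,
  for \<open>i = 1, ..., n\<close>; the region lies on the side of each containing the fundamental
  alcove.\<close>

definition sommers_region :: "nat \<Rightarrow> nat \<Rightarrow> (int \<Rightarrow> real) set" where
  "sommers_region m n = {x \<in> coroot_space n.
     \<forall>i \<in> {1..int n}. ext_coord n x i \<ge> ext_coord n x (i + int m)}"

definition labels_sommers_alcove :: "nat \<Rightarrow> nat \<Rightarrow> (int \<Rightarrow> int) \<Rightarrow> bool" where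
  "labels_sommers_alcove m n u \<longleftrightarrow> u \<in> affine_sym n \<and> alcove n u \<subseteq> sommers_region m n"

subsection \<open>Filters\<close>

definition level :: "nat \<Rightarrow> nat \<Rightarrow> int \<Rightarrow> int \<Rightarrow> int" where
  "level m n i j = i * int m + j * int n"

definition mn_filter :: "nat \<Rightarrow> nat \<Rightarrow> (int \<times> int) set \<Rightarrow> bool" where
  "mn_filter m n F \<longleftrightarrow> F \<noteq> {} \<and> F \<noteq> UNIV
     \<and> (\<forall>i j i' j'. (i, j) \<in> F \<longrightarrow> i \<le> i' \<longrightarrow> j \<le> j' \<longrightarrow> (i', j') \<in> F)
     \<and> (\<forall>i j i' j'. (i, j) \<in> F \<longrightarrow> level m n i' j' = level m n i j \<longrightarrow> (i', j') \<in> F)"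

definition row_minima :: "nat \<Rightarrow> nat \<Rightarrow> (int \<times> int) set \<Rightarrow> int set" where
  "row_minima m n F = {x. \<exists>j. (\<exists>i. (i, j) \<in> F \<and> x = level m n i j)
     \<and> (\<forall>i. (i, j) \<in> F \<longrightarrow> x \<le> level m n i j)}"

definition column_minima :: "nat \<Rightarrow> nat \<Rightarrow> (int \<times> int) set \<Rightarrow> int set" where
  "column_minima m n F = {y. \<exists>i. (\<exists>j. (i, j) \<in> F \<and> y = level m n i j)
     \<and> (\<forall>j. (i, j) \<in> F \<longrightarrow> y \<le> level m n i j)}"

definition balanced_filter :: "nat \<Rightarrow> nat \<Rightarrow> (int \<times> int) set \<Rightarrow> bool" where
  "balanced_filter m n F \<longleftrightarrow> mn_filter m n F
     \<and> (\<Sum>x \<in> row_minima m n F. x) = int ((m + 1) choose 2)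
     \<and> (\<Sum>y \<in> column_minima m n F. y) = int ((n + 1) choose 2)"

subsection \<open>Filter tuples\<close>

text \<open>A filter tuple is carried as the list of its \<open>n + 1\<close> filters together with the list
  of the \<open>n\<close> integers by which consecutive filters differ.\<close>

type_synonym filter_tuple = "(int \<times> int) set list \<times> int list"

definition mn_filter_tuple :: "nat \<Rightarrow> nat \<Rightarrow> filter_tuple \<Rightarrow> bool" where
  "mn_filter_tuple m n t \<longleftrightarrow> (case t of (P, p) \<Rightarrow>
     length P = n + 1 \<and> length p = n \<and> (\<forall>F \<in> set P. mn_filter m n F)
     \<and> (\<forall>i < n. p ! i \<in> row_minima m n (P ! i)
          \<and> row_minima m n (P ! (i + 1))
              = (row_minima m n (P ! i) - {p ! i}) \<union> {p ! i + int m})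
     \<and> row_minima m n (P ! n) = (\<lambda>x. x + int n) ` row_minima m n (P ! 0))"

definition balanced_filter_tuple :: "nat \<Rightarrow> nat \<Rightarrow> filter_tuple \<Rightarrow> bool" where
  "balanced_filter_tuple m n t \<longleftrightarrow> mn_filter_tuple m n t \<and> balanced_filter m n (fst t ! 0)"

definition tuple_list :: "filter_tuple \<Rightarrow> int list" where
  "tuple_list t = snd t"

subsection \<open>Comparison with the combinatorial description of the Sommers region\<close>

lemma ext_coord_shift:
  assumes "n > 0"
  shows "ext_coord n x (i + k * int n) = ext_coord n x i - of_int k"
proof -
  have e: "i + k * int n - 1 = (i - 1) + k * int n" by simp
  show ?thesis unfolding ext_coord_def e using assms by simp
qed

lemma ext_coord_base:
  assumes "i \<in> {1..int n}"
  shows "ext_coord n x i = x i"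
  using assms by (simp add: ext_coord_def div_pos_pos_trivial)

lemma affine_sym_shift:
  assumes "w \<in> affine_sym n"
  shows "w (i + k * int n) = w i + k * int n"
proof -
  have 1: "w (i + int k * int n) = w i + int k * int n" for i k
  proof (induction k)
    case (Suc k)
    have "w (i + int (Suc k) * int n) = w ((i + int k * int n) + int n)"
      by (simp add: algebra_simps)
    also have "\<dots> = w (i + int k * int n) + int n"
      using assms unfolding affine_sym_def by blast
    finally show ?case using Suc by (simp add: algebra_simps)
  qed simp
  show ?thesis
  proof (cases "k \<ge> 0")
    case True
    then show ?thesis using 1[of i "nat k"] by simp
  next
    case False
    then show ?thesis using 1[of "i + k * int n" "nat (- k)"] by simp
  qed
qed

lemma ext_coord_decompose:
  assumes "n > 0"
  obtains r k where "i = r + k * int n" "r \<in> {1..int n}"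
proof
  show "i = ((i - 1) mod int n + 1) + ((i - 1) div int n) * int n"
    using div_mult_mod_eq[of "i - 1" "int n"] by linarith
  show "(i - 1) mod int n + 1 \<in> {1..int n}"
    using assms by (simp add: add1_zle_eq)
qed

lemma inv_affine_sym:
  assumes "w \<in> affine_sym n" "n > 0"
  shows "inv w (i + k * int n) = inv w i + k * int n"
proof -
  have b: "bij w" using assms unfolding affine_sym_def by blast
  have "w (inv w i + k * int n) = i + k * int n"
    using affine_sym_shift[OF assms(1)] b by (simp add: bij_is_surj surj_f_inv_f)
  then show ?thesis using b by (metis bij_is_inj inv_f_f)
qed

lemma ext_coord_act:
  assumes "w \<in> affine_sym n" "n > 0"
  shows "ext_coord n (affine_act n w x) a = ext_coord n x (inv w a)"
proof -
  obtain r k where a: "a = r + k * int n" and r: "r \<in> {1..int n}"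
    using ext_coord_decompose[OF assms(2)] .
  show ?thesis
    unfolding a inv_affine_sym[OF assms] ext_coord_shift[OF assms(2)]
    using r by (simp add: ext_coord_base affine_act_def del: atLeastAtMost_iff)
qed

lemma bij_betw_inv_affine_sym_mod:
  assumes "w \<in> affine_sym n" "n > 0"
  shows "bij_betw (\<lambda>i. (inv w i - 1) mod int n + 1) {1..int n} {1..int n}"
proof -
  define g where "g i = (inv w i - 1) mod int n + 1" for i
  have b: "bij w" using assms unfolding affine_sym_def by blast
  have g: "inv w i - ((inv w i - 1) div int n) * int n = g i" for i
    unfolding g_def using div_mult_mod_eq[of "inv w i - 1" "int n"] by linarith
  have gi: "g i = inv w (i + (- ((inv w i - 1) div int n)) * int n)" for i
    using g[of i] unfolding inv_affine_sym[OF assms] by simp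
  have "inj_on g {1..int n}"
  proof (rule inj_onI)
    fix i j assume ij: "i \<in> {1..int n}" "j \<in> {1..int n}" "g i = g j"
    have "inj (inv w)" using b by (simp add: bij_imp_bij_inv bij_is_inj)
    then have "i + (- ((inv w i - 1) div int n)) * int n = j + (- ((inv w j - 1) div int n)) * int n"
      using ij(3) unfolding gi[of i] gi[of j] by (meson injD)
    then have "(i - 1) mod int n = (j - 1) mod int n"
      by (metis add.commute add_diff_eq diff_add_eq mod_mult_self1)
    then show "i = j" using ij(1,2) by (simp add: mod_pos_pos_trivial)
  qed
  moreover have sub: "g ` {1..int n} \<subseteq> {1..int n}"
    unfolding g_def using assms(2) by (auto simp: add1_zle_eq)
  ultimately have "bij_betw g {1..int n} {1..int n}"
    by (simp add: bij_betw_def endo_inj_surj)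
  then show ?thesis unfolding g_def .
qed

lemma sum_int_interval: "(\<Sum>i = 1..int n. i) = int ((n + 1) choose 2)"
proof (induction n)
  case (Suc n)
  have "{1..int (Suc n)} = insert (int (Suc n)) {1..int n}" by auto
  then show ?case using Suc by (simp add: numeral_2_eq_2)
qed simp

lemma sum_div_inv_affine_sym:
  assumes "w \<in> affine_sym n" "n > 0"
  shows "(\<Sum>i = 1..int n. (inv w i - 1) div int n) = 0"
proof -
  let ?d = "\<lambda>i. (inv w i - 1) div int n"
  let ?g = "\<lambda>i. (inv w i - 1) mod int n + 1"
  have b: "bij w" using assms unfolding affine_sym_def by blast
  have "w (?g i) = i - ?d i * int n" for i
  proof -
    have "?g i = inv w i + (- ?d i) * int n"
      using div_mult_mod_eq[of "inv w i - 1" "int n"] by linarith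
    then have "w (?g i) = w (inv w i) + (- ?d i) * int n"
      using affine_sym_shift[OF assms(1)] by metis
    then show ?thesis using b by (simp add: bij_is_surj surj_f_inv_f)
  qed
  then have "(\<Sum>i = 1..int n. w (?g i)) = (\<Sum>i = 1..int n. i) - (\<Sum>i = 1..int n. ?d i) * int n"
    by (simp add: sum_subtractf sum_distrib_right)
  moreover have "(\<Sum>i = 1..int n. w (?g i)) = (\<Sum>i = 1..int n. w i)"
    by (rule sum.reindex_bij_betw[OF bij_betw_inv_affine_sym_mod[OF assms]])
  moreover have "(\<Sum>i = 1..int n. w i) = (\<Sum>i = 1..int n. i)"
    using assms(1) unfolding affine_sym_def sum_int_interval by blast
  ultimately show ?thesis using assms(2) by simp
qed

lemma inv_in_affine_sym:
  assumes "w \<in> affine_sym n" "n > 0"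
  shows "inv w \<in> affine_sym n"
proof -
  let ?d = "\<lambda>i. (inv w i - 1) div int n"
  let ?g = "\<lambda>i. (inv w i - 1) mod int n + 1"
  have b: "bij w" using assms unfolding affine_sym_def by blast
  have "inv w i = ?g i + ?d i * int n" for i
    using div_mult_mod_eq[of "inv w i - 1" "int n"] by linarith
  then have "(\<Sum>i = 1..int n. inv w i) = (\<Sum>i = 1..int n. ?g i + ?d i * int n)"
    by (intro sum.cong) auto
  also have "\<dots> = (\<Sum>i = 1..int n. ?g i) + (\<Sum>i = 1..int n. ?d i) * int n"
    by (simp only: sum.distrib sum_distrib_right)
  also have "\<dots> = (\<Sum>i = 1..int n. i)"
    using sum.reindex_bij_betw[OF bij_betw_inv_affine_sym_mod[OF assms], of "\<lambda>i. i"]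
      sum_div_inv_affine_sym[OF assms] by simp
  finally have "(\<Sum>i = 1..int n. inv w i) = int ((n + 1) choose 2)"
    unfolding sum_int_interval .
  then show ?thesis
    unfolding affine_sym_def
    using b inv_affine_sym[OF assms, of _ 1] by (simp add: bij_imp_bij_inv)
qed

lemma affine_act_in_coroot_space:
  assumes "w \<in> affine_sym n" "n > 0" "x \<in> coroot_space n"
  shows "affine_act n w x \<in> coroot_space n"
proof -
  have "(\<Sum>i = 1..int n. affine_act n w x i)
      = (\<Sum>i = 1..int n. x ((inv w i - 1) mod int n + 1)) - of_int (\<Sum>i = 1..int n. (inv w i - 1) div int n)"
    by (simp add: affine_act_def ext_coord_def sum_subtractf)
  also have "\<dots> = (\<Sum>i = 1..int n. x i)"
    using sum.reindex_bij_betw[OF bij_betw_inv_affine_sym_mod[OF assms(1,2)], of x]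
      sum_div_inv_affine_sym[OF assms(1,2)] by simp
  finally show ?thesis using assms(3) by (simp add: coroot_space_def affine_act_def)
qed

lemma ext_coord_strict_antimono:
  assumes "n > 0" "x \<in> fundamental_alcove n" "a < b"
  shows "ext_coord n x a > ext_coord n x b"
proof -
  have step: "ext_coord n x a > ext_coord n x (a + 1)" for a
  proof -
    obtain r k where a: "a = r + k * int n" and r: "r \<in> {1..int n}"
      using ext_coord_decompose[OF assms(1)] .
    have "ext_coord n x r > ext_coord n x (r + 1)"
    proof (cases "r < int n")
      case True
      then have "r \<in> {1..<int n}" "r + 1 \<in> {1..int n}" using r by auto
      then show ?thesis
        using assms(2) r by (simp add: ext_coord_base fundamental_alcove_def del: atLeastAtMost_iff)
    next
      case False
      then have rn: "r = int n" using r by auto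
      have "1 \<in> {1..int n}" using assms(1) by auto
      then show ?thesis
        using ext_coord_shift[OF assms(1), of x 1 1] assms(2) r unfolding rn
        by (simp add: ext_coord_base fundamental_alcove_def add.commute del: atLeastAtMost_iff)
    qed
    then show ?thesis
      using ext_coord_shift[OF assms(1), of x r k] ext_coord_shift[OF assms(1), of x "r + 1" k]
      unfolding a by (simp add: algebra_simps)
  qed
  show ?thesis using assms(3)
  proof (induction rule: int_gr_induct)
    case base
    show ?case by (rule step)
  next
    case (step i)
    then show ?case using \<open>\<And>a. ext_coord n x a > ext_coord n x (a + 1)\<close>[of i] by linarith
  qed
qed

lemma fundamental_alcove_nonempty:
  assumes "n > 0"
  shows "fundamental_alcove n \<noteq> {}"
proof -
  define c where "c = (\<Sum>i = 1..int n. - real_of_int i / real n) / real n"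
  define x where "x = (\<lambda>i \<in> {1..int n}. - real_of_int i / real n - c)"
  have "(\<Sum>i = 1..int n. x i) = (\<Sum>i = 1..int n. - real_of_int i / real n) - real n * c"
    by (simp add: x_def sum_subtractf)
  also have "\<dots> = 0" using assms by (simp add: c_def)
  finally have "x \<in> coroot_space n" by (simp add: coroot_space_def x_def)
  moreover have "x i > x (i + 1)" if "i \<in> {1..<int n}" for i
    using that assms by (simp add: x_def divide_strict_right_mono)
  moreover have "x (int n) > x 1 - 1"
    using assms by (simp add: x_def)
  ultimately show ?thesis unfolding fundamental_alcove_def by blast
qed

theorem labels_sommers_alcove_iff:
  assumes "n > 0" "m > 0" and w: "w \<in> affine_sym n"
  shows "labels_sommers_alcove m n (inv w) \<longleftrightarrow> (\<forall>i j. i < j \<longrightarrow> w i - w j \<noteq> int m)"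
proof -
  have b: "bij w" using w unfolding affine_sym_def by blast
  then have iw: "inv (inv w) = w" by (rule inv_inv_eq)
  have wi: "w (inv w a) = a" "inv w (w a) = a" for a
    using b by (simp_all add: bij_is_surj surj_f_inv_f bij_is_inj)
  obtain x0 where x0: "x0 \<in> fundamental_alcove n"
    using fundamental_alcove_nonempty[OF assms(1)] by blast
  have ge_iff: "ext_coord n x a \<ge> ext_coord n x b \<longleftrightarrow> a \<le> b"
    if "x \<in> fundamental_alcove n" for x a b
    using ext_coord_strict_antimono[OF assms(1) that, of a b]
      ext_coord_strict_antimono[OF assms(1) that, of b a]
    by (cases a b rule: linorder_cases) auto
  have "labels_sommers_alcove m n (inv w)
      \<longleftrightarrow> (\<forall>x \<in> fundamental_alcove n. affine_act n w x \<in> sommers_region m n)"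
    using inv_in_affine_sym[OF w assms(1)]
    by (auto simp: labels_sommers_alcove_def alcove_def iw)
  also have "\<dots> \<longleftrightarrow> (\<forall>x \<in> fundamental_alcove n. \<forall>i \<in> {1..int n}. inv w i \<le> inv w (i + int m))"
  proof (rule ball_cong[OF refl])
    fix x assume x: "x \<in> fundamental_alcove n"
    then have "x \<in> coroot_space n" by (simp add: fundamental_alcove_def)
    then show "affine_act n w x \<in> sommers_region m n
        \<longleftrightarrow> (\<forall>i \<in> {1..int n}. inv w i \<le> inv w (i + int m))"
      using affine_act_in_coroot_space[OF w assms(1)] ge_iff[OF x]
      by (simp add: sommers_region_def ext_coord_act[OF w assms(1)])
  qed
  also have "\<dots> \<longleftrightarrow> (\<forall>i \<in> {1..int n}. inv w i \<le> inv w (i + int m))"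
    using x0 by blast
  also have "\<dots> \<longleftrightarrow> (\<forall>a. inv w a \<le> inv w (a + int m))"
  proof (intro iffI allI)
    fix a assume *: "\<forall>i \<in> {1..int n}. inv w i \<le> inv w (i + int m)"
    obtain r k where a: "a = r + k * int n" and r: "r \<in> {1..int n}"
      using ext_coord_decompose[OF assms(1)] .
    have am: "a + int m = (r + int m) + k * int n" using a by simp
    show "inv w a \<le> inv w (a + int m)"
      unfolding am inv_affine_sym[OF w assms(1)] unfolding a inv_affine_sym[OF w assms(1)]
      using *[rule_format, OF r] by simp
  qed auto
  also have "\<dots> \<longleftrightarrow> (\<forall>i j. i < j \<longrightarrow> w i - w j \<noteq> int m)"
  proof (intro iffI allI impI)
    fix i j :: int assume "\<forall>a. inv w a \<le> inv w (a + int m)" "i < j"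
    then show "w i - w j \<noteq> int m"
      by (metis wi(2) add.commute diff_add_cancel not_le)
  next
    fix a assume *: "\<forall>i j. i < j \<longrightarrow> w i - w j \<noteq> int m"
    have "w (inv w (a + int m)) - w (inv w a) = int m" by (simp add: wi)
    then show "inv w a \<le> inv w (a + int m)" using * not_le by blast
  qed
  finally show ?thesis .
qed

end

theory Submission
  imports Defs
begin

text \<open>Since \<open>m\<close> and \<open>n\<close> are coprime, every integer is a level, so a filter is the same as a proper
  nonempty set \<open>L\<close> of integers closed under adding \<open>m\<close> and \<open>n\<close>; its row minima are the \<open>x \<in> L\<close>
  with \<open>x - m \<notin> L\<close>, and they determine \<open>L\<close>. Replacing the row minimum \<open>p\<close> by \<open>p + m\<close> amounts to
  deleting \<open>p\<close> from \<open>L\<close>. Hence the filters of a tuple with \<open>n(\<pp>) = [w 1, \<dots>, w n]\<close> have the level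
  sets \<open>{w k | k > i}\<close> for \<open>i = 0, \<dots>, n\<close>, and these are closed under adding \<open>m\<close> exactly when
  \<open>w i - w j \<noteq> m\<close> for all \<open>i < j\<close>. Both sums in the balance condition are governed by the number of
  elements of \<open>L\<close> below a large bound, so either one implies the other.\<close>

subsection \<open>Level sets\<close>

definition level_set :: "nat \<Rightarrow> nat \<Rightarrow> int set \<Rightarrow> bool" where
  "level_set m n L \<longleftrightarrow> L \<noteq> {} \<and> L \<noteq> UNIV \<and> (\<forall>x \<in> L. x + int m \<in> L \<and> x + int n \<in> L)"

definition filter_of :: "nat \<Rightarrow> nat \<Rightarrow> int set \<Rightarrow> (int \<times> int) set" where
  "filter_of m n L = {(i, j). level m n i j \<in> L}"

text \<open>For \<open>L\<close> bounded below and closed under adding \<open>d\<close>, these are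
  the least elements of \<open>L\<close> in the residue classes modulo \<open>d\<close>. The step
  \<open>d\<close> is a parameter so that rows (\<open>d = m\<close>) and columns
  (\<open>d = n\<close>) are treated alike.\<close>

definition minima :: "nat \<Rightarrow> int set \<Rightarrow> int set" where
  "minima d L = {x \<in> L. x - int d \<notin> L}"

lemma level_setD:
  assumes "level_set m n L"
  shows "\<exists>x. x \<in> L" "\<exists>x. x \<notin> L" "\<forall>x \<in> L. x + int m \<in> L" "\<forall>x \<in> L. x + int n \<in> L"
proof -
  have "L \<noteq> {}" "L \<noteq> UNIV" using assms by (simp_all add: level_set_def)
  then show "\<exists>x. x \<in> L" "\<exists>x. x \<notin> L" by blast+
qed (use assms in \<open>simp_all add: level_set_def\<close>)

lemma level_set_commute: "level_set m n L \<longleftrightarrow> level_set n m L"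
  unfolding level_set_def by (simp only: conj_commute)

lemma add_multiple_mem:
  assumes "\<forall>x \<in> L. x + int d \<in> L" "x \<in> L" "k \<ge> 0"
  shows "x + k * int d \<in> L"
  using assms(3)
proof (induction k rule: int_ge_induct)
  case (step k)
  then have "x + k * int d + int d \<in> L" using assms(1) by blast
  then show ?case by (simp add: algebra_simps)
qed (use assms in simp)

lemma level_set_add:
  assumes "level_set m n L" "x \<in> L" "i \<ge> 0" "j \<ge> 0"
  shows "x + i * int m + j * int n \<in> L"
  using add_multiple_mem[OF level_setD(3)[OF assms(1)] assms(2,3)]
  by (rule add_multiple_mem[OF level_setD(4)[OF assms(1)] _ assms(4)])

section \<open>Levels of lattice points and the extent of a level set\<close>

lemma level_surj:
  assumes "coprime m n"
  obtains i j where "level m n i j = x"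
proof -
  obtain u v where "u * int m + v * int n = gcd (int m) (int n)"
    using bezout_int by blast
  also have "gcd (int m) (int n) = 1"
    using assms by (simp flip: coprime_iff_gcd_eq_1)
  finally have "x * u * int m + x * v * int n = x"
    by (metis distrib_left mult.assoc mult.right_neutral)
  then show ?thesis using that[of "x * u" "x * v"] by (simp add: level_def)
qed

text \<open>The vector \<open>(n, -m)\<close> has level 0, so the first coordinate can be reduced
  modulo \<open>n\<close>.\<close>

lemma level_surj_bounded:
  assumes "coprime m n" "n > 0"
  obtains i j where "level m n i j = x" "0 \<le> i" "i < int n"
proof -
  obtain u v where uv: "level m n u v = x" using level_surj[OF assms(1)] .
  have "level m n (u mod int n) (v + u div int n * int m) = level m n u v"
  proof -
    have "u * int m = (u div int n * int n + u mod int n) * int m" by simp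
    then have "u * int m = u div int n * int n * int m + u mod int n * int m"
      by (simp only: distrib_right)
    then show ?thesis unfolding level_def by (simp add: algebra_simps)
  qed
  then show ?thesis using that uv assms(2) by simp
qed

text \<open>Write \<open>y - x\<close> as a level with \<open>0 \<le> i < n\<close>. As
  \<open>i * m \<le> m * n \<le> y - x\<close>, the other coordinate is nonnegative too, so
  \<open>y\<close> is reached from \<open>x\<close> by adding copies of \<open>m\<close> and
  \<open>n\<close>.\<close>

lemma level_set_contains_above:
  assumes "coprime m n" "n > 0" "level_set m n L" "x \<in> L" "x + int m * int n \<le> y"
  shows "y \<in> L"
proof -
  obtain i j where ij: "level m n i j = y - x" "0 \<le> i" "i < int n"
    using level_surj_bounded[OF assms(1,2)] .
  have "i * int m \<le> int n * int m" using ij by (intro mult_right_mono) auto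
  then have "j * int n \<ge> 0" using ij(1) assms(5) by (simp add: level_def mult.commute)
  then have "j \<ge> 0" using assms(2) by (simp add: zero_le_mult_iff)
  then have "x + i * int m + j * int n \<in> L"
    using level_set_add assms(3,4) ij(2) by blast
  then show ?thesis using ij(1) by (simp add: level_def algebra_simps)
qed

text \<open>An element at or below \<open>z - m * n\<close> would force the missing \<open>z\<close>
  into \<open>L\<close>.\<close>

lemma level_set_bounded_below:
  assumes "coprime m n" "n > 0" "level_set m n L"
  obtains B where "\<forall>x \<in> L. B \<le> x"
proof -
  obtain z where "z \<notin> L" using level_setD(2)[OF assms(3)] by blast
  then have "\<forall>x \<in> L. z - int m * int n \<le> x"
    using level_set_contains_above[OF assms] by (metis diff_le_eq linorder_le_cases)
  then show ?thesis using that by blast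
qed

section \<open>Filters as preimages of level sets\<close>

lemma mn_filter_filter_of:
  assumes "coprime m n" "level_set m n L"
  shows "mn_filter m n (filter_of m n L)"
proof -
  have mem: "(i, j) \<in> filter_of m n L \<longleftrightarrow> level m n i j \<in> L" for i j
    by (simp add: filter_of_def)
  obtain x y where xy: "x \<in> L" "y \<notin> L" using level_setD(1,2)[OF assms(2)] by blast
  obtain a b where "level m n a b = x" using level_surj[OF assms(1)] .
  then have "(a, b) \<in> filter_of m n L" using mem xy by simp
  then have "filter_of m n L \<noteq> {}" by blast
  moreover obtain c d where "level m n c d = y" using level_surj[OF assms(1)] .
  then have "(c, d) \<notin> filter_of m n L" using mem xy by simp
  then have "filter_of m n L \<noteq> UNIV" by blast
  moreover have "level m n i' j' \<in> L" if "level m n i j \<in> L" "i \<le> i'" "j \<le> j'" for i j i' j'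
  proof -
    have "level m n i j + (i' - i) * int m + (j' - j) * int n \<in> L"
      using that by (intro level_set_add[OF assms(2)]) auto
    then show ?thesis by (simp add: level_def algebra_simps)
  qed
  ultimately show ?thesis unfolding mn_filter_def mem by simp
qed

text \<open>Take for \<open>L\<close> the levels of the points of \<open>F\<close>: closure under
  equal level makes \<open>F\<close> its full preimage, and unit steps in the two coordinates add
  \<open>m\<close> and \<open>n\<close>.\<close>

lemma mn_filter_obtain_level_set:
  assumes "mn_filter m n F"
  obtains L where "level_set m n L" "F = filter_of m n L"
proof
  let ?L = "{level m n i j | i j. (i, j) \<in> F}"
  have up: "\<forall>i j i' j'. (i, j) \<in> F \<longrightarrow> i \<le> i' \<longrightarrow> j \<le> j' \<longrightarrow> (i', j') \<in> F"
    using assms unfolding mn_filter_def by (elim conjE)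
  have same_level: "\<forall>i j i' j'. (i, j) \<in> F \<longrightarrow> level m n i' j' = level m n i j \<longrightarrow> (i', j') \<in> F"
    using assms unfolding mn_filter_def by (elim conjE)
  have mem: "level m n i j \<in> ?L \<longleftrightarrow> (i, j) \<in> F" for i j
  proof
    assume "level m n i j \<in> ?L"
    then obtain a b where "(a, b) \<in> F" "level m n i j = level m n a b" by blast
    then show "(i, j) \<in> F" by (rule same_level[rule_format])
  qed blast
  show "F = filter_of m n ?L" unfolding filter_of_def mem by simp
  have add: "level m n i j + int m \<in> ?L \<and> level m n i j + int n \<in> ?L" if "(i, j) \<in> F" for i j
  proof -
    have "(i + 1, j) \<in> F" "(i, j + 1) \<in> F"
      using up[rule_format, OF that, of "i + 1" j] up[rule_format, OF that, of i "j + 1"] by auto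
    then show ?thesis
      using mem[of "i + 1" j] mem[of i "j + 1"] by (simp add: level_def algebra_simps)
  qed
  have "\<forall>x \<in> ?L. x + int m \<in> ?L \<and> x + int n \<in> ?L"
  proof
    fix x assume "x \<in> ?L"
    then obtain i j where x: "x = level m n i j" and "(i, j) \<in> F" by blast
    then show "x + int m \<in> ?L \<and> x + int n \<in> ?L" unfolding x by (intro add)
  qed
  moreover have "?L \<noteq> {}" "?L \<noteq> UNIV"
  proof -
    have F: "F \<noteq> {}" "F \<noteq> UNIV" using assms by (simp_all add: mn_filter_def)
    then show "?L \<noteq> {}" by auto
    obtain a b where "(a, b) \<notin> F" using F(2) by auto
    then have "level m n a b \<notin> ?L" unfolding mem .
    then show "?L \<noteq> UNIV" by blast
  qed
  ultimately show "level_set m n ?L" unfolding level_set_def by (intro conjI)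
qed

subsection \<open>Minima\<close>

text \<open>Starting from \<open>x + k * d\<close> with \<open>k < 0\<close>, adding
  \<open>d\<close> a further \<open>-k - 1\<close> times would reach the excluded
  \<open>x - d\<close>.\<close>

lemma minima_least:
  assumes "\<forall>x \<in> L. x + int d \<in> L" "x - int d \<notin> L" "x + k * int d \<in> L"
  shows "0 \<le> k"
proof (rule ccontr)
  assume "\<not> 0 \<le> k"
  then have "x + k * int d + (- k - 1) * int d \<in> L"
    using assms by (intro add_multiple_mem[OF assms(1,3)]) auto
  then show False using assms(2) by (simp add: algebra_simps)
qed

text \<open>One step along a row changes the level by \<open>m\<close>. Conversely, coprimality
  places each \<open>x\<close> of \<open>minima m L\<close> at some lattice point, and
  \<open>minima_least\<close> excludes smaller levels of \<open>L\<close> in its row.\<close>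

lemma row_minima_filter_of:
  assumes "coprime m n" "m > 0" "level_set m n L"
  shows "row_minima m n (filter_of m n L) = minima m L"
proof (intro set_eqI iffI)
  fix x assume "x \<in> row_minima m n (filter_of m n L)"
  then obtain i j where x: "x = level m n i j" "x \<in> L"
      and least: "\<And>i'. level m n i' j \<in> L \<Longrightarrow> x \<le> level m n i' j"
    by (auto simp: row_minima_def filter_of_def)
  have "x - int m = level m n (i - 1) j" by (simp add: x level_def algebra_simps)
  then show "x \<in> minima m L" using least[of "i - 1"] x assms(2) by (auto simp: minima_def)
next
  fix x assume x: "x \<in> minima m L"
  obtain i j where ij: "level m n i j = x" using level_surj[OF assms(1)] .
  have "x \<le> level m n i' j" if "level m n i' j \<in> L" for i'
  proof -
    have e: "level m n i' j = x + (i' - i) * int m"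
      by (simp add: level_def algebra_simps flip: ij)
    then have "0 \<le> i' - i"
      using minima_least[of L m x "i' - i"] that x level_setD(3)[OF assms(3)]
      unfolding e minima_def by simp
    then show ?thesis unfolding e by simp
  qed
  then show "x \<in> row_minima m n (filter_of m n L)"
    using x ij by (auto simp: row_minima_def filter_of_def minima_def)
qed

text \<open>Exchanging the two coordinates exchanges \<open>m\<close> with \<open>n\<close> and
  columns with rows.\<close>

lemma column_minima_filter_of:
  assumes "coprime m n" "n > 0" "level_set m n L"
  shows "column_minima m n (filter_of m n L) = minima n L"
proof -
  have "column_minima m n (filter_of m n L) = row_minima n m (filter_of n m L)"
    by (simp add: column_minima_def row_minima_def filter_of_def level_def add.commute)
  then show ?thesis
    using row_minima_filter_of[of n m L] assms
    by (simp add: coprime_commute level_set_commute)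
qed

text \<open>Stepping down by \<open>d\<close> inside \<open>L\<close> ends at a minimum because of
  the lower bound; that minimum lies in \<open>L'\<close>, and stepping back up stays in
  \<open>L'\<close>.\<close>

lemma minima_subset_imp_subset:
  assumes "d > 0" "\<forall>x \<in> L'. x + int d \<in> L'" "\<forall>x \<in> L. B \<le> x"
    and "minima d L \<subseteq> minima d L'"
  shows "L \<subseteq> L'"
proof
  fix x assume "x \<in> L"
  then show "x \<in> L'"
  proof (induction "nat (x - B)" arbitrary: x rule: less_induct)
    case less
    show ?case
    proof (cases "x - int d \<in> L")
      case True
      then have "nat (x - int d - B) < nat (x - B)" using assms(1,3) by force
      then have "x - int d \<in> L'" using less True by blast
      then show ?thesis using assms(2) by force
    next
      case False
      then show ?thesis using assms(4) less.prems by (auto simp: minima_def)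
    qed
  qed
qed

text \<open>With \<open>d = m\<close> this turns the row conditions of a tuple into equations of
  level sets; with \<open>d = n\<close> it identifies the first level set.\<close>

lemma minima_inject:
  assumes "d > 0" "\<forall>x \<in> L. x + int d \<in> L" "\<forall>x \<in> L'. x + int d \<in> L'"
    and "\<forall>x \<in> L. B \<le> x" "\<forall>x \<in> L'. B' \<le> x" "minima d L = minima d L'"
  shows "L = L'"
proof
  show "L \<subseteq> L'" using assms(6) by (intro minima_subset_imp_subset[OF assms(1,3,4)]) simp
  show "L' \<subseteq> L" using assms(6) by (intro minima_subset_imp_subset[OF assms(1,2,5)]) simp
qed

text \<open>Deleting \<open>p\<close> takes away the predecessor of \<open>p + d\<close> and of no
  other element.\<close>

lemma minima_remove:
  assumes "d > 0" "\<forall>x \<in> L. x + int d \<in> L" "p \<in> minima d L"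
  shows "minima d (L - {p}) = (minima d L - {p}) \<union> {p + int d}"
proof -
  have "p \<in> L" "p - int d \<notin> L" "p + int d \<in> L" using assms(2,3) by (simp_all add: minima_def)
  then show ?thesis using assms(1) by (auto simp: minima_def)
qed

lemma minima_shift: "minima d ((\<lambda>x. x + c) ` L) = (\<lambda>x. x + c) ` minima d L"
  by (force simp: minima_def image_iff algebra_simps)

section \<open>Sums of minima and balance\<close>

lemma sum_minima:
  assumes "d > 0" "\<forall>x \<in> L. x + int d \<in> L" "finite (L \<inter> {..K})" "{K<..} \<subseteq> L"
  shows "\<Sum> (minima d L) = int ((d + 1) choose 2) + int d * (K - int (card (L \<inter> {..K})))"
proof -
  define A where "A = L \<inter> {..K}"
  let ?f = "\<lambda>x. x + int d" and ?W = "A \<union> {K + 1..K + int d}"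
  have fin: "finite A" using assms(3) by (simp add: A_def)
  have sub: "?f ` A \<subseteq> ?W"
    using assms(2) by (auto simp: A_def)
  \<comment> \<open>Beyond \<open>K + d\<close> every predecessor lies in \<open>L\<close>, so
    \<open>?W\<close> contains all minima; the members of \<open>?W\<close> whose predecessor is in
    \<open>L\<close> are the translates of \<open>A\<close>. In the difference of sums,
    \<open>\<Sum> A\<close> cancels.\<close>
  have "minima d L = ?W - ?f ` A"
  proof (intro set_eqI iffI)
    fix x assume x: "x \<in> minima d L"
    then have "\<not> K < x - int d" using assms(4) by (auto simp: minima_def)
    then show "x \<in> ?W - ?f ` A" using x by (auto simp: minima_def A_def)
  next
    fix x assume x: "x \<in> ?W - ?f ` A"
    then have "x \<in> L" "x - int d \<le> K" using assms(4) by (auto simp: A_def)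
    moreover have "x - int d \<notin> A"
      using x by (metis DiffD2 diff_add_cancel imageI)
    ultimately show "x \<in> minima d L" by (simp add: minima_def A_def)
  qed
  then have "\<Sum> (minima d L) = \<Sum> ?W - \<Sum> (?f ` A)"
    using sub fin by (simp add: sum_diff)
  also have "\<Sum> ?W = \<Sum> A + \<Sum> {K + 1..K + int d}"
    using fin by (intro sum.union_disjoint) (auto simp: A_def)
  also have "\<Sum> (?f ` A) = \<Sum> A + int d * int (card A)"
    by (subst sum.reindex) (auto simp: inj_on_def sum.distrib)
  also have "\<Sum> {K + 1..K + int d} = (\<Sum>i = 1..int d. i + K)"
    by (rule sum.reindex_bij_witness[of _ "\<lambda>i. i + K" "\<lambda>x. x - K"]) auto
  also have "\<dots> = int ((d + 1) choose 2) + int d * K"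
    by (simp add: sum.distrib sum_int_interval)
  finally show ?thesis by (simp add: A_def algebra_simps)
qed

text \<open>With one cutoff \<open>K\<close> for both sums, \<open>sum_minima\<close> reduces either
  condition to the same equation \<open>K = card (L \<inter> {..K})\<close>.\<close>

lemma sum_minima_balanced_iff:
  assumes "coprime m n" "m > 0" "n > 0" "level_set m n L"
  shows "\<Sum> (minima m L) = int ((m + 1) choose 2) \<longleftrightarrow> \<Sum> (minima n L) = int ((n + 1) choose 2)"
proof -
  obtain B where B: "\<forall>x \<in> L. B \<le> x" using level_set_bounded_below[OF assms(1,3,4)] .
  obtain z where "z \<in> L" using level_setD(1)[OF assms(4)] by blast
  then have K: "{z + int m * int n<..} \<subseteq> L"
    using level_set_contains_above[OF assms(1,3,4)] by auto
  have "L \<inter> {..z + int m * int n} \<subseteq> {B..z + int m * int n}" using B by auto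
  then have fin: "finite (L \<inter> {..z + int m * int n})" by (rule finite_subset) simp
  show ?thesis
    using sum_minima[OF assms(2) level_setD(3)[OF assms(4)] fin K]
      sum_minima[OF assms(3) level_setD(4)[OF assms(4)] fin K] assms(2,3) by simp
qed

subsection \<open>The tuple of an affine permutation\<close>

lemma affine_sym_add_period:
  assumes "w \<in> affine_sym n"
  shows "w (i + int n) = w i + int n"
  using affine_sym_shift[OF assms, of i 1] by simp

text \<open>By periodicity, subtracting \<open>n\<close> from the value \<open>w k\<close> moves the
  index to \<open>k - n\<close>, which for positive \<open>k\<close> stops being positive exactly
  when \<open>k \<le> n\<close>.\<close>

lemma minima_image_greaterThan:
  assumes "w \<in> affine_sym n"
  shows "minima n (w ` {0<..}) = w ` {1..int n}"
proof -
  have inj: "inj w" using assms by (auto simp: affine_sym_def bij_is_inj)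
  have "w k - int n = w (k - int n)" for k
    using affine_sym_add_period[OF assms, of "k - int n"] by simp
  then have shifted: "w k - int n \<in> w ` {0<..} \<longleftrightarrow> int n < k" for k
    by (simp add: inj_image_mem_iff[OF inj])
  have "minima n (w ` {0<..}) = w ` {k \<in> {0<..}. w k - int n \<notin> w ` {0<..}}"
    unfolding minima_def by blast
  also have "{k \<in> {0<..}. w k - int n \<notin> w ` {0<..}} = {1..int n}"
    unfolding shifted by auto
  finally show ?thesis .
qed

lemma balanced_tuple_of_affine:
  assumes "m > 0" "n > 0" "coprime m n" and w: "w \<in> affine_sym n"
    and ne: "\<forall>i j. i < j \<longrightarrow> w i - w j \<noteq> int m"
  shows "balanced_filter_tuple m n
    (map (\<lambda>i. filter_of m n (w ` {int i<..})) [0..<n + 1], map w [1..int n])"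
proof -
  let ?U = "\<lambda>i :: int. w ` {i<..}"
  have bij: "bij w" using w by (auto simp: affine_sym_def)
  then have inj: "inj w" by (rule bij_is_inj)
  have per: "w (k + int n) = w k + int n" for k by (rule affine_sym_add_period[OF w])
  \<comment> \<open>The index \<open>l\<close> of the value \<open>w k + m\<close> is not before
    \<open>k\<close> by \<open>ne\<close>, and differs from \<open>k\<close> since
    \<open>m > 0\<close>.\<close>
  have addm: "w k + int m \<in> ?U k" for k
  proof -
    obtain l where l: "w l = w k + int m" using bij by (metis bij_pointE)
    have "w l - w k = int m" using l by simp
    then have "\<not> l < k" using ne by blast
    moreover have "l \<noteq> k" using l assms(1) by auto
    ultimately have "k < l" by linarith
    then show ?thesis unfolding l[symmetric] by blast
  qed
  have ls: "level_set m n (?U i)" for i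
    unfolding level_set_def
  proof (intro conjI ballI)
    show "?U i \<noteq> UNIV" using inj_image_mem_iff[OF inj, of i "{i<..}"] by auto
    fix x assume "x \<in> ?U i"
    then obtain k where k: "x = w k" "i < k" by auto
    then show "x + int m \<in> ?U i" using addm[of k] by force
    show "x + int n \<in> ?U i" using k per[of k] assms(2) by (metis imageI greaterThan_iff
        add_strict_increasing2 of_nat_0_le_iff add.commute)
  qed auto
  have rm: "row_minima m n (filter_of m n (?U i)) = minima m (?U i)" for i
    using row_minima_filter_of assms(1,3) ls by blast
  \<comment> \<open>List positions start at 0, so position \<open>i\<close> holds
    \<open>w (1 + i)\<close>, the one value in \<open>?U i\<close> but not in
    \<open>?U (1 + i)\<close>.\<close>
  have step: "w (1 + i) \<in> minima m (?U i)
      \<and> minima m (?U (1 + i)) = (minima m (?U i) - {w (1 + i)}) \<union> {w (1 + i) + int m}" for i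
  proof -
    have "w (1 + i) - int m \<notin> ?U i"
    proof
      assume "w (1 + i) - int m \<in> ?U i"
      then obtain k where k: "w k = w (1 + i) - int m" "i < k" by auto
      then have "w (1 + i) - w k = int m" by simp
      moreover have "1 + i < k \<or> k = 1 + i" using k by linarith
      ultimately show False using ne assms(1) by auto
    qed
    then have p: "w (1 + i) \<in> minima m (?U i)" by (auto simp: minima_def)
    have "{1 + i<..} = {i<..} - {1 + i}" by auto
    then have "?U (1 + i) = ?U i - {w (1 + i)}" by (simp add: image_set_diff[OF inj])
    then show ?thesis using minima_remove[OF assms(1) level_setD(3)[OF ls] p] p by simp
  qed
  have "?U (int n) = (\<lambda>x. x + int n) ` ?U 0"
  proof -
    have "{int n<..} = (\<lambda>k. k + int n) ` {0<..}"
      by (auto simp: image_iff) (metis diff_add_cancel diff_gt_0_iff_gt greaterThan_iff)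
    then show ?thesis by (simp add: image_image per)
  qed
  then have last: "minima m (?U (int n)) = (\<lambda>x. x + int n) ` minima m (?U 0)"
    by (simp only: minima_shift)
  \<comment> \<open>The column minima are the window values, whose sum is fixed by
    \<open>affine_sym\<close>; the row sum then follows from
    \<open>sum_minima_balanced_iff\<close>.\<close>
  have sum_n: "\<Sum> (minima n (?U 0)) = int ((n + 1) choose 2)"
  proof -
    have "\<Sum> (w ` {1..int n}) = (\<Sum>i = 1..int n. w i)"
      using inj by (subst sum.reindex) (auto simp: inj_on_def)
    then show ?thesis using w by (simp add: minima_image_greaterThan[OF w] affine_sym_def)
  qed
  then have bal: "balanced_filter m n (filter_of m n (?U 0))"
    unfolding balanced_filter_def
    using mn_filter_filter_of[OF assms(3) ls] rm[of 0]
      column_minima_filter_of[OF assms(3,2) ls[of 0]]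
      sum_minima_balanced_iff[OF assms(3,1,2) ls[of 0]] by simp
  have nth: "map (\<lambda>i. filter_of m n (?U (int i))) [0..<n + 1] ! i = filter_of m n (?U (int i))"
    if "i \<le> n" for i using that by (simp del: upt_Suc)
  show ?thesis
    unfolding balanced_filter_tuple_def mn_filter_tuple_def
    using bal mn_filter_filter_of[OF assms(3) ls] step last
    by (auto simp: nth rm simp del: upt_Suc)
qed

text \<open>The tuple deletes \<open>w 1, ..., w n\<close> one at a time from its first level set
  \<open>L 0\<close> and ends at \<open>L 0\<close> shifted by \<open>n\<close>. Hence the deleted
  values are the minima of \<open>L 0\<close> for step \<open>n\<close>. They are also those of the
  set of values of \<open>w\<close> at positive indices, so the two sets agree.\<close>

lemma tuple_level_sets:
  assumes "m > 0" "n > 0" "coprime m n" and w: "w \<in> affine_sym n"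
    and t: "mn_filter_tuple m n (P, map w [1..int n])" and i: "i \<le> n"
  shows "level_set m n (w ` {int i<..})"
proof -
  have inj: "inj w" using w by (auto simp: affine_sym_def bij_is_inj)
  have per: "w (k + int n) = w k + int n" for k by (rule affine_sym_add_period[OF w])
  have "\<forall>i. i \<le> n \<longrightarrow> (\<exists>L. level_set m n L \<and> P ! i = filter_of m n L)"
  proof (intro allI impI)
    fix i assume "i \<le> n"
    then have "mn_filter m n (P ! i)" using t by (auto simp: mn_filter_tuple_def)
    then show "\<exists>L. level_set m n L \<and> P ! i = filter_of m n L"
      using mn_filter_obtain_level_set by blast
  qed
  then obtain L where "\<forall>i. i \<le> n \<longrightarrow> level_set m n (L i) \<and> P ! i = filter_of m n (L i)"
    unfolding choice_iff' by blast
  then have L: "level_set m n (L i)" and P: "P ! i = filter_of m n (L i)" if "i \<le> n" for i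
    using that by simp_all
  have rm: "row_minima m n (P ! i) = minima m (L i)" if "i \<le> n" for i
    using row_minima_filter_of[OF assms(3,1)] L P that by simp
  have clm: "\<forall>x \<in> L i. x + int m \<in> L i" if "i \<le> n" for i
    using level_setD(3)[OF L[OF that]] .
  have bd: "\<exists>B. \<forall>x \<in> L i. B \<le> x" if "i \<le> n" for i
    using level_set_bounded_below[OF assms(3,2) L[OF that]] by blast
  have mem: "w (int i + 1) \<in> L i" and step: "L (Suc i) = L i - {w (int i + 1)}" if lt: "i < n" for i
  proof -
    let ?p = "w (int i + 1)"
    have "map w [1..int n] ! i = ?p" using lt by (simp add: add.commute)
    then have p: "?p \<in> minima m (L i)"
      and "minima m (L (Suc i)) = (minima m (L i) - {?p}) \<union> {?p + int m}"
      using t lt rm[of i] rm[of "Suc i"] by (auto simp: mn_filter_tuple_def)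
    then have eq: "minima m (L (Suc i)) = minima m (L i - {?p})"
      using minima_remove[OF assms(1) clm p] lt by simp
    show "?p \<in> L i" using p by (simp add: minima_def)
    \<comment> \<open>No element is sent to \<open>?p\<close>, since \<open>?p - m\<close> lies
      outside \<open>L i\<close>.\<close>
    have cl: "\<forall>x \<in> L i - {?p}. x + int m \<in> L i - {?p}"
    proof
      fix x assume x: "x \<in> L i - {?p}"
      then have "x + int m \<in> L i" using clm[of i] lt by simp
      moreover have "x \<noteq> ?p - int m" using x p by (auto simp: minima_def)
      then have "x + int m \<noteq> ?p" by linarith
      ultimately show "x + int m \<in> L i - {?p}" by blast
    qed
    obtain B where B: "\<forall>x \<in> L (Suc i). B \<le> x" using bd[OF Suc_leI[OF lt]] by blast
    obtain B' where "\<forall>x \<in> L i. B' \<le> x" using bd[OF less_imp_le[OF lt]] by blast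
    then have B': "\<forall>x \<in> L i - {?p}. B' \<le> x" by simp
    show "L (Suc i) = L i - {?p}"
      using lt by (intro minima_inject[OF assms(1) clm cl B B' eq]) simp
  qed
  have removed: "L i = L 0 - w ` {1..int i}" if "i \<le> n" for i
    using that
  proof (induction i)
    case (Suc i)
    have "{1..int (Suc i)} = insert (int i + 1) {1..int i}" by auto
    then show ?case using Suc step[of i] by auto
  qed simp
  \<comment> \<open>The value \<open>w k\<close> is deleted from \<open>L (k - 1)\<close>, which is
    a subset of \<open>L 0\<close>.\<close>
  have initial: "w ` {1..int n} \<subseteq> L 0"
  proof (rule image_subsetI)
    fix k assume k: "k \<in> {1..int n}"
    define i where "i = nat (k - 1)"
    have "int i + 1 = k" "i < n" using k by (auto simp: i_def)
    then show "w k \<in> L 0" using mem[of i] removed[of i] by auto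
  qed
  have Ln: "L n = (\<lambda>x. x + int n) ` L 0"
  proof -
    have eq: "minima m (L n) = minima m ((\<lambda>x. x + int n) ` L 0)"
      using t rm[of n] rm[of 0] by (simp add: mn_filter_tuple_def minima_shift)
    have cl: "\<forall>x \<in> (\<lambda>x. x + int n) ` L 0. x + int m \<in> (\<lambda>x. x + int n) ` L 0"
    proof (rule ballI, erule imageE)
      fix x y assume "x = y + int n" "y \<in> L 0"
      then show "x + int m \<in> (\<lambda>x. x + int n) ` L 0"
        using clm[of 0] by (intro image_eqI[of _ _ "y + int m"]) auto
    qed
    obtain B where B: "\<forall>x \<in> L n. B \<le> x" using bd[of n] by blast
    obtain B' where "\<forall>x \<in> L 0. B' \<le> x" using bd[of 0] by blast
    then have B': "\<forall>x \<in> (\<lambda>x. x + int n) ` L 0. B' + int n \<le> x" by auto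
    show ?thesis by (intro minima_inject[OF assms(1) clm cl B B' eq]) simp
  qed
  \<comment> \<open>An element of \<open>L 0\<close> is minimal for step \<open>n\<close> when it
    lies outside the shift of \<open>L 0\<close> by \<open>n\<close>. That shift is
    \<open>L n\<close>, so the minima are the deleted values.\<close>
  have min_n: "minima n (L 0) = minima n (w ` {0<..})"
  proof -
    have "minima n (L 0) = L 0 - (\<lambda>x. x + int n) ` L 0"
      by (auto simp: minima_def image_iff) (metis diff_add_cancel)
    then show ?thesis
      using Ln removed[of n] initial minima_image_greaterThan[OF w] by auto
  qed
  have "L 0 = w ` {0<..}"
  proof -
    obtain B where B: "\<forall>x \<in> L 0. B \<le> x" using bd[of 0] by blast
    have cl: "\<forall>x \<in> L 0. x + int n \<in> L 0" using level_setD(4)[OF L[of 0]] by simp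
    have cl': "\<forall>x \<in> w ` {0<..}. x + int n \<in> w ` {0<..}"
    proof
      fix x assume "x \<in> w ` {0<..}"
      then obtain k where "x = w k" "0 < k" by auto
      then have "x + int n = w (k + int n)" "0 < k + int n" using per by auto
      then show "x + int n \<in> w ` {0<..}" by blast
    qed
    \<comment> \<open>This passes the lower bound of \<open>L 0\<close> on to the values at positive
      indices, as \<open>minima_inject\<close> requires. Each positive index is a window index plus
      a nonnegative multiple of \<open>n\<close>.\<close>
    have sub: "w ` {0<..} \<subseteq> L 0"
    proof (rule image_subsetI)
      fix k :: int assume "k \<in> {0<..}"
      moreover obtain r q where k: "k = r + q * int n" and r: "r \<in> {1..int n}"
        using ext_coord_decompose[OF assms(2)] .
      ultimately have "0 < (q + 1) * int n" by (simp add: algebra_simps)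
      then have "q \<ge> 0" by (simp add: zero_less_mult_iff)
      moreover have "w r \<in> L 0" using initial r by blast
      ultimately show "w k \<in> L 0"
        using add_multiple_mem[OF cl, of "w r" q] affine_sym_shift[OF w, of r q] k by simp
    qed
    then have B': "\<forall>x \<in> w ` {0<..}. B \<le> x" using B by blast
    show ?thesis by (rule minima_inject[OF assms(2) cl cl' B B' min_n])
  qed
  moreover have "{int i<..} = {0<..} - {1..int i}" by auto
  ultimately have "w ` {int i<..} = L i"
    using removed[OF i] by (simp add: image_set_diff[OF inj])
  then show ?thesis using L[OF i] by simp
qed

text \<open>Translating both indices by a multiple of \<open>n\<close> moves \<open>i\<close> to
  \<open>r\<close> in the window. Were the difference \<open>m\<close>, closure under adding
  \<open>m\<close> would put \<open>w r\<close> among the values at indices beyond \<open>r\<close>,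
  against injectivity.\<close>

lemma tuple_imp_difference_ne:
  assumes "m > 0" "n > 0" "coprime m n" and w: "w \<in> affine_sym n"
    and t: "mn_filter_tuple m n (P, map w [1..int n])" and "i < j"
  shows "w i - w j \<noteq> int m"
proof
  assume eq: "w i - w j = int m"
  have inj: "inj w" using w by (auto simp: affine_sym_def bij_is_inj)
  obtain r q where i: "i = r + q * int n" and r: "r \<in> {1..int n}"
    using ext_coord_decompose[OF assms(2)] .
  have "w r = w i - q * int n" "w (j - q * int n) = w j - q * int n"
    using affine_sym_shift[OF w, of r q] affine_sym_shift[OF w, of "j - q * int n" q] i by auto
  then have e: "w r = w (j - q * int n) + int m" using eq by simp
  have "level_set m n (w ` {r<..})"
    using tuple_level_sets[OF assms(1-3) w t, of "nat r"] r by (simp add: nat_le_iff)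
  moreover have "w (j - q * int n) \<in> w ` {r<..}" using \<open>i < j\<close> i by auto
  ultimately have "w r \<in> w ` {r<..}" unfolding e using level_setD(3) by blast
  then show False by (simp add: inj_image_mem_iff[OF inj])
qed

theorem theorem6p10:
  fixes m n :: nat and w :: "int \<Rightarrow> int"
  assumes "m > 0" and "n > 0" and "coprime m n"
    and "w \<in> affine_sym n"
  shows "labels_sommers_alcove m n (inv w) \<longleftrightarrow>
    (\<exists>t. balanced_filter_tuple m n t \<and> map w [1..int n] = tuple_list t)"
proof -
  \<comment> \<open>By \<open>labels_sommers_alcove_iff\<close> the alcove condition is the same
    condition on differences, so it remains to compare that condition with tuples.\<close>
  have "(\<exists>t. balanced_filter_tuple m n t \<and> map w [1..int n] = tuple_list t)
      \<longleftrightarrow> (\<forall>i j. i < j \<longrightarrow> w i - w j \<noteq> int m)"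
  proof
    assume "\<exists>t. balanced_filter_tuple m n t \<and> map w [1..int n] = tuple_list t"
    then obtain P where "mn_filter_tuple m n (P, map w [1..int n])"
      by (auto simp: balanced_filter_tuple_def tuple_list_def)
    then show "\<forall>i j. i < j \<longrightarrow> w i - w j \<noteq> int m"
      using tuple_imp_difference_ne[OF assms] by blast
  next
    assume "\<forall>i j. i < j \<longrightarrow> w i - w j \<noteq> int m"
    then show "\<exists>t. balanced_filter_tuple m n t \<and> map w [1..int n] = tuple_list t"
      using balanced_tuple_of_affine[OF assms] unfolding tuple_list_def by force
  qed
  then show ?thesis using labels_sommers_alcove_iff[OF assms(2,1,4)] by simp
qed

end
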